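(* Let $n\ge1$ and $k\ge0$ be integers and $0<\theta\le1$. Then, with the limit taken over positive integers $m$, $$\lim_{m\to\infty}\operatorname{Occ}(k\mid n,m,\theta)=\operatorname{Bin}(k\mid n,\theta).$$
   Context: Noncentral Stirling numbers of the second kind: for an integer $n\ge0$ and real $\phi$, the numbers $S(n,k,\phi)$, $0\le k\le n$, are defined by the polynomial identity $(x+\phi)^n=\sum_{k=0}^n S(n,k,\phi)(x)_k$, where $(x)_k=\prod_{i=0}^{k-1}(x-i)$; $S(n,k,\phi)=0$ for $k>n$. Extended occupancy distribution: for integers $m,n\ge1$, $k\ge0$, $0<\theta\le1$, $\operatorname{Occ}(k\mid n,m,\theta)=\frac{\theta^n}{m^n}(m)_k\,S\big(n,k,m\tfrac{1-\theta}{\theta}\big)$. $\operatorname{Bin}(k\mid n,\theta)=\binom nk\theta^k(1-\theta)^{n-k}$ (zero for $k>n$), with $0^0=1$. *)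

theory Defs
  imports "HOL-Probability.Probability_Mass_Function"
begin

definition falling_fact :: "real \<Rightarrow> nat \<Rightarrow> real" where
  "falling_fact x k = (\<Prod>i<k. x - real i)"

definition is_noncentral_Stirling :: "nat \<Rightarrow> real \<Rightarrow> (nat \<Rightarrow> real) \<Rightarrow> bool" where
  "is_noncentral_Stirling n \<phi> s \<longleftrightarrow>
     (\<forall>x::real. (x + \<phi>) ^ n = (\<Sum>k\<le>n. s k * falling_fact x k)) \<and> (\<forall>k>n. s k = 0)"

lemma falling_fact_Suc: "falling_fact x (Suc k) = falling_fact x k * (x - real k)"
  by (simp add: falling_fact_def)

lemma falling_fact_of_nat_eq_0: "j < k \<Longrightarrow> falling_fact (real j) k = 0"
  by (auto simp: falling_fact_def)

lemma falling_fact_of_nat_self: "falling_fact (real k) k \<noteq> 0"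
  by (auto simp: falling_fact_def)

lemma falling_fact_coeffs_unique:
  assumes "\<And>x::real. (\<Sum>k\<le>n. c k * falling_fact x k) = 0" and "k \<le> n"
  shows "c k = (0::real)"
  using assms(2)
proof (induction k rule: less_induct)
  case (less k)
  have "c i * falling_fact (real k) i = (if i = k then c k * falling_fact (real k) k else 0)"
    if "i \<le> n" for i
    using that less.IH[of i] falling_fact_of_nat_eq_0[of k i]
    by (cases i k rule: linorder_cases) auto
  then have "(\<Sum>i\<le>n. c i * falling_fact (real k) i)
      = (\<Sum>i\<le>n. if i = k then c k * falling_fact (real k) k else 0)"
    by (intro sum.cong refl) (simp only: atMost_iff)
  also have "\<dots> = c k * falling_fact (real k) k"
    using less.prems by simp
  finally have "(\<Sum>i\<le>n. c i * falling_fact (real k) i) = c k * falling_fact (real k) k" .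
  then show ?case
    using assms(1)[of "real k"] falling_fact_of_nat_self[of k] by simp
qed

lemma is_noncentral_Stirling_exists: "\<exists>s. is_noncentral_Stirling n \<phi> s"
proof (induction n)
  case 0
  show ?case
    by (rule exI[of _ "\<lambda>k. if k = 0 then 1 else 0"])
       (simp add: is_noncentral_Stirling_def falling_fact_def)
next
  case (Suc n)
  then obtain s where s: "\<And>x. (x + \<phi>) ^ n = (\<Sum>k\<le>n. s k * falling_fact x k)"
    and z: "\<And>k. k > n \<Longrightarrow> s k = 0"
    by (auto simp: is_noncentral_Stirling_def)
  define t where "t k = (if k = 0 then 0 else s (k - 1)) + (real k + \<phi>) * s k" for k
  have "(x + \<phi>) ^ Suc n = (\<Sum>k\<le>Suc n. t k * falling_fact x k)" for x
  proof -
    have "(x + \<phi>) ^ Suc n = (\<Sum>k\<le>n. s k * falling_fact x k * (x + \<phi>))"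
      by (simp add: s sum_distrib_left mult_ac)
    also have "\<dots> = (\<Sum>k\<le>n. s k * falling_fact x (Suc k))
        + (\<Sum>k\<le>n. (real k + \<phi>) * s k * falling_fact x k)"
      unfolding sum.distrib[symmetric]
      by (rule sum.cong) (simp_all add: falling_fact_Suc algebra_simps)
    also have "(\<Sum>k\<le>n. s k * falling_fact x (Suc k))
        = (\<Sum>k\<le>Suc n. (if k = 0 then 0 else s (k - 1)) * falling_fact x k)"
      by (subst sum.atMost_Suc_shift) simp
    also have "(\<Sum>k\<le>n. (real k + \<phi>) * s k * falling_fact x k)
        = (\<Sum>k\<le>Suc n. (real k + \<phi>) * s k * falling_fact x k)"
      by (simp add: z)
    finally show ?thesis
      by (simp only: t_def distrib_right sum.distrib)
  qed
  moreover have "t k = 0" if "k > Suc n" for k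
    using that by (simp add: t_def z)
  ultimately show ?case
    unfolding is_noncentral_Stirling_def by blast
qed

lemma is_noncentral_Stirling_unique:
  assumes "is_noncentral_Stirling n \<phi> s" "is_noncentral_Stirling n \<phi> t"
  shows "s = t"
proof
  fix k
  have "(\<Sum>k\<le>n. (s k - t k) * falling_fact x k) = 0" for x
    using assms by (simp add: is_noncentral_Stirling_def left_diff_distrib sum_subtractf)
  then have "s k = t k" if "k \<le> n"
    using falling_fact_coeffs_unique[of "\<lambda>k. s k - t k" n k] that by simp
  moreover have "s k = 0" "t k = 0" if "k > n"
    using assms that unfolding is_noncentral_Stirling_def by blast+
  ultimately show "s k = t k"
    by (cases "k \<le> n") simp_all
qed

definition noncentral_Stirling :: "nat \<Rightarrow> nat \<Rightarrow> real \<Rightarrow> real" where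
  "noncentral_Stirling n k \<phi> = (THE s. is_noncentral_Stirling n \<phi> s) k"

lemma is_noncentral_Stirling_noncentral_Stirling:
  "is_noncentral_Stirling n \<phi> (\<lambda>k. noncentral_Stirling n k \<phi>)"
proof -
  have "\<exists>!s. is_noncentral_Stirling n \<phi> s"
    by (rule ex_ex1I[OF is_noncentral_Stirling_exists is_noncentral_Stirling_unique])
  from theI'[OF this] show ?thesis
    by (simp only: noncentral_Stirling_def)
qed

definition Occ :: "nat \<Rightarrow> nat \<Rightarrow> nat \<Rightarrow> real \<Rightarrow> real" where
  "Occ k n m \<theta> = \<theta> ^ n / real m ^ n * falling_fact (real m) k
     * noncentral_Stirling n k (real m * ((1 - \<theta>) / \<theta>))"

end

(* The Pascal-type recurrence S(n+1,k+1,phi) = S(n,k,phi) + (k+1+phi) S(n,k+1,phi), at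
   phi = m(1-theta)/theta, becomes a recurrence for Occ whose coefficients theta(m-k)/m and
   theta(k+1)/m + (1-theta) tend to theta and 1-theta, the coefficients of the binomial
   recurrence. The limit follows by induction on n. *)
theory Submission
  imports Defs
begin

lemma noncentral_Stirling_0: "noncentral_Stirling 0 k \<phi> = (if k = 0 then 1 else 0)"
proof -
  have "is_noncentral_Stirling 0 \<phi> (\<lambda>k. if k = 0 then 1 else 0)"
    by (simp add: is_noncentral_Stirling_def falling_fact_def)
  from is_noncentral_Stirling_unique[OF is_noncentral_Stirling_noncentral_Stirling this]
  show ?thesis by (rule fun_cong)
qed

text \<open>Multiply the expansion of (x + \<phi>)^n by x + \<phi>, written as (x - k) + (k +
  \<phi>) in the k-th term: x - k extends (x)_k to (x)_(k+1), while k + \<phi> only rescales the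
  coefficient. Uniqueness of the coefficients then identifies them.\<close>

lemma noncentral_Stirling_Suc:
  "noncentral_Stirling (Suc n) k \<phi> =
     (if k = 0 then 0 else noncentral_Stirling n (k - 1) \<phi>)
       + (real k + \<phi>) * noncentral_Stirling n k \<phi>"
proof -
  define s where "s k = noncentral_Stirling n k \<phi>" for k
  have "is_noncentral_Stirling n \<phi> s"
    unfolding s_def by (rule is_noncentral_Stirling_noncentral_Stirling)
  then have s: "(x + \<phi>) ^ n = (\<Sum>k\<le>n. s k * falling_fact x k)"
    and z: "j > n \<Longrightarrow> s j = 0" for x j
    by (auto simp: is_noncentral_Stirling_def)
  define t where "t k = (if k = 0 then 0 else s (k - 1)) + (real k + \<phi>) * s k" for k
  have "(x + \<phi>) ^ Suc n = (\<Sum>k\<le>Suc n. t k * falling_fact x k)" for x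
  proof -
    have "(x + \<phi>) ^ Suc n = (\<Sum>k\<le>n. s k * falling_fact x k * (x + \<phi>))"
      by (simp add: s sum_distrib_left mult_ac)
    also have "\<dots> = (\<Sum>k\<le>n. s k * falling_fact x (Suc k))
        + (\<Sum>k\<le>n. (real k + \<phi>) * s k * falling_fact x k)"
      unfolding sum.distrib[symmetric]
      by (rule sum.cong) (simp_all add: falling_fact_Suc algebra_simps)
    also have "(\<Sum>k\<le>n. s k * falling_fact x (Suc k))
        = (\<Sum>k\<le>Suc n. (if k = 0 then 0 else s (k - 1)) * falling_fact x k)"
      by (subst sum.atMost_Suc_shift) simp
    \<comment> \<open>The added term at \<open>Suc n\<close> is zero by \<open>z\<close>; both sums
      now have the same range and can be merged.\<close>
    also have "(\<Sum>k\<le>n. (real k + \<phi>) * s k * falling_fact x k)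
        = (\<Sum>k\<le>Suc n. (real k + \<phi>) * s k * falling_fact x k)"
      by (simp add: z)
    finally show ?thesis
      by (simp only: t_def distrib_right sum.distrib)
  qed
  then have "is_noncentral_Stirling (Suc n) \<phi> t"
    by (simp add: is_noncentral_Stirling_def t_def z)
  from is_noncentral_Stirling_unique[OF is_noncentral_Stirling_noncentral_Stirling this]
  have "noncentral_Stirling (Suc n) k \<phi> = t k" by (rule fun_cong)
  then show ?thesis by (simp add: t_def s_def)
qed

lemma Occ_0: "Occ k 0 m \<theta> = (if k = 0 then 1 else 0)"
  by (simp add: Occ_def noncentral_Stirling_0 falling_fact_def)

text \<open>Only the coefficient \<phi> = m(1 - \<theta>)/\<theta> of the Stirling recurrence
  survives, and the new prefactor \<theta>/m turns it into 1 - \<theta>.\<close>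

lemma Occ_Suc_0:
  assumes "m > 0" and "\<theta> \<noteq> 0"
  shows "Occ 0 (Suc n) m \<theta> = (1 - \<theta>) * Occ 0 n m \<theta>"
  using assms by (simp add: Occ_def noncentral_Stirling_Suc)

text \<open>Raising n by one multiplies the prefactor by \<theta>/m. In the first term of the
  Stirling recurrence it meets the last factor m - k of (m)_(k+1), in the second the coefficient k +
  1 + \<phi>.\<close>

lemma Occ_Suc_Suc:
  assumes "m > 0" and "\<theta> \<noteq> 0"
  shows "Occ (Suc k) (Suc n) m \<theta> =
    \<theta> * (1 - real k / real m) * Occ k n m \<theta>
      + (\<theta> * (real (Suc k) / real m) + (1 - \<theta>)) * Occ (Suc k) n m \<theta>"
proof -
  define \<phi> where "\<phi> = real m * ((1 - \<theta>) / \<theta>)"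
  define c where "c = \<theta> ^ n / real m ^ n"
  define F where "F = falling_fact (real m) k"
  define A where "A = noncentral_Stirling n k \<phi>"
  define B where "B = noncentral_Stirling n (Suc k) \<phi>"
  have a: "\<theta> / real m * (real m - real k) = \<theta> * (1 - real k / real m)"
    using assms by (simp add: field_simps)
  have b: "\<theta> / real m * (real (Suc k) + \<phi>) = \<theta> * (real (Suc k) / real m) + (1 - \<theta>)"
    using assms by (simp add: \<phi>_def field_simps)
  have "Occ (Suc k) (Suc n) m \<theta> =
      \<theta> / real m * c * (F * (real m - real k)) * (A + (real (Suc k) + \<phi>) * B)"
    by (simp add: Occ_def noncentral_Stirling_Suc falling_fact_Suc c_def F_def A_def B_def \<phi>_def)
  also have "\<dots> = (\<theta> / real m * (real m - real k)) * (c * F * A)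
      + (\<theta> / real m * (real (Suc k) + \<phi>)) * (c * (F * (real m - real k)) * B)"
    by (simp only: distrib_left mult_ac)
  also have "\<dots> = (\<theta> / real m * (real m - real k)) * Occ k n m \<theta>
      + (\<theta> / real m * (real (Suc k) + \<phi>)) * Occ (Suc k) n m \<theta>"
    by (simp add: Occ_def falling_fact_Suc c_def F_def A_def B_def \<phi>_def)
  finally show ?thesis
    by (simp only: a b)
qed

lemma pmf_binomial_Suc_Suc:
  assumes "0 \<le> \<theta>" and "\<theta> \<le> 1"
  shows "pmf (binomial_pmf (Suc n) \<theta>) (Suc k) =
    \<theta> * pmf (binomial_pmf n \<theta>) k + (1 - \<theta>) * pmf (binomial_pmf n \<theta>) (Suc k)"
proof (cases "k < n")
  case True
  \<comment> \<open>With one factor split off, all terms share the same powers and Pascal's rule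
    remains.\<close>
  then have "(1 - \<theta>) ^ (n - k) = (1 - \<theta>) * (1 - \<theta>) ^ (n - Suc k)"
    by (simp add: Suc_diff_Suc flip: power_Suc)
  then show ?thesis
    using assms by (simp add: pmf_binomial distrib_left distrib_right mult_ac)
next
  \<comment> \<open>Here \<open>Suc k\<close> exceeds n, so the last term vanishes; the rest is
    \<theta>^(n+1) on both sides if k = n, and zero if k > n.\<close>
  case False
  then show ?thesis
    using assms by (simp add: pmf_binomial binomial_eq_0)
qed

theorem mainTheorem7:
  fixes n k :: nat and \<theta> :: real
  assumes "n \<ge> 1" and "0 < \<theta>" and "\<theta> \<le> 1"
  shows "(\<lambda>m::nat. Occ k n m \<theta>) \<longlonglongrightarrow> pmf (binomial_pmf n \<theta>) k"
proof -
  have vanish: "(\<lambda>m. c / real m) \<longlonglongrightarrow> 0" for c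
    by (rule lim_const_over_n)
  show ?thesis
  \<comment> \<open>k must vary: the limit at \<open>Suc j\<close> draws on those at
    \<open>j\<close> and \<open>Suc j\<close> for the smaller n.\<close>
  proof (induction n arbitrary: k)
    case 0
    show ?case
      using assms by (cases k) (simp_all add: Occ_0 pmf_binomial)
  next
    case (Suc n)
    show ?case
    proof (cases k)
      case 0
      \<comment> \<open>The recurrences divide by m and are available for m > 0 only, hence equality
        holds eventually.\<close>
      have "\<forall>\<^sub>F m in sequentially. (1 - \<theta>) * Occ 0 n m \<theta> = Occ 0 (Suc n) m \<theta>"
        using eventually_gt_at_top[of 0] by eventually_elim (use assms in \<open>simp add: Occ_Suc_0\<close>)
      moreover have "(\<lambda>m. (1 - \<theta>) * Occ 0 n m \<theta>) \<longlonglongrightarrow> (1 - \<theta>) * pmf (binomial_pmf n \<theta>) 0"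
        by (intro tendsto_intros Suc.IH)
      moreover have "(1 - \<theta>) * pmf (binomial_pmf n \<theta>) 0 = pmf (binomial_pmf (Suc n) \<theta>) 0"
        using assms by (simp add: pmf_binomial)
      ultimately show ?thesis
        using 0 by (simp add: Lim_transform_eventually)
    next
      case (Suc j)
      let ?g = "\<lambda>m. \<theta> * (1 - real j / real m) * Occ j n m \<theta>
        + (\<theta> * (real (Suc j) / real m) + (1 - \<theta>)) * Occ (Suc j) n m \<theta>"
      have ev: "\<forall>\<^sub>F m in sequentially. ?g m = Occ (Suc j) (Suc n) m \<theta>"
        using eventually_gt_at_top[of 0] by eventually_elim (use assms in \<open>simp only: Occ_Suc_Suc\<close>)
      \<comment> \<open>The limit is left unsimplified, with 0 in place of each quotient by m, so
        that it matches \<open>?g\<close> term by term.\<close>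
      have lim: "?g \<longlonglongrightarrow> \<theta> * (1 - 0) * pmf (binomial_pmf n \<theta>) j
          + (\<theta> * 0 + (1 - \<theta>)) * pmf (binomial_pmf n \<theta>) (Suc j)"
        by (intro tendsto_intros vanish Suc.IH)
      have eq: "\<theta> * (1 - 0) * pmf (binomial_pmf n \<theta>) j
          + (\<theta> * 0 + (1 - \<theta>)) * pmf (binomial_pmf n \<theta>) (Suc j)
        = pmf (binomial_pmf (Suc n) \<theta>) (Suc j)"
        using assms pmf_binomial_Suc_Suc[of \<theta> n j] by (simp del: pmf_binomial)
      show ?thesis
        using Lim_transform_eventually[OF lim ev] unfolding Suc eq .
    qed
  qed
qed

end
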